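(* Let $n$ be a nonnegative integer. For any $f\in C[0,1]$, $$P'_{\mathcal{P}_n}(f)(p)=p\quad\text{for any }p\in\mathcal{P}_n\setminus\{\theta\}.$$
   Context: $C[0,1]$ is the Banach space of continuous real-valued functions on $[0,1]$ with norm $\|f\|=\max_{0\le t\le1}|f(t)|$ and origin $\theta$ (the zero function). $\mathcal{P}_n$ is the closed subspace of all real polynomials of degree less than or equal to $n$. The metric projection $P_{\mathcal{P}_n}:C[0,1]\to\mathcal{P}_n$ assigns to $f$ its (unique) best uniform approximation from $\mathcal{P}_n$, i.e. the unique $p\in\mathcal{P}_n$ with $\|f-p\|=\min\{\|f-q\|:q\in\mathcal{P}_n\}$. The Gâteaux directional derivative of $P_{\mathcal{P}_n}$ at $f$ along a direction $g\ne\theta$ is the norm limit $$P'_{\mathcal{P}_n}(f)(g)=\lim_{t\downarrow0}\frac{P_{\mathcal{P}_n}(f+tg)-P_{\mathcal{P}_n}(f)}{t},$$ when it exists; the claim includes the existence of the limit. *)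

theory Defs
  imports "HOL-Analysis.Analysis" "HOL-Computational_Algebra.Polynomial"
begin

text \<open>The interval [0,1] as a metric space of its own, so that the library's Banach space of
  bounded continuous functions on it is C[0,1].\<close>

typedef unit_interval = "{0..1::real}"
  morphisms real_of_ui ui_of_real
  by (rule exI[of _ 0]) simp

instantiation unit_interval :: metric_space
begin

definition dist_unit_interval :: "unit_interval \<Rightarrow> unit_interval \<Rightarrow> real" where
  "dist_unit_interval x y = dist (real_of_ui x) (real_of_ui y)"

definition uniformity_unit_interval :: "(unit_interval \<times> unit_interval) filter" where
  "uniformity_unit_interval = (INF e\<in>{0<..}. principal {(x, y). dist x y < e})"

definition open_unit_interval :: "unit_interval set \<Rightarrow> bool" where
  "open_unit_interval U \<longleftrightarrow> (\<forall>x\<in>U. \<forall>\<^sub>F (x', y) in uniformity. x' = x \<longrightarrow> y \<in> U)"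

instance
proof
  fix x y z :: unit_interval
  show "dist x y = 0 \<longleftrightarrow> x = y"
    by (simp add: dist_unit_interval_def real_of_ui_inject)
  show "dist x y \<le> dist x z + dist y z"
    unfolding dist_unit_interval_def by (rule dist_triangle2)
qed (simp_all only: uniformity_unit_interval_def open_unit_interval_def)

end

lemma compact_UNIV_unit_interval: "compact (UNIV :: unit_interval set)"
proof -
  have "continuous_on {0..1} ui_of_real"
    unfolding continuous_on_iff
    by (auto simp: dist_unit_interval_def ui_of_real_inverse)
  moreover have "ui_of_real ` {0..1} = UNIV"
    using type_definition.Abs_image[OF type_definition_unit_interval] .
  ultimately show ?thesis
    by (metis compact_Icc compact_continuous_image)
qed

type_synonym C01 = "unit_interval \<Rightarrow>\<^sub>C real"

text \<open>Boundedness is no restriction, and the supremum norm of the library is the maximum norm.\<close>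

lemma bcontfun_unit_interval_iff:
  fixes f :: "unit_interval \<Rightarrow> real"
  shows "f \<in> bcontfun \<longleftrightarrow> continuous_on UNIV f"
  using compact_continuous_image[OF _ compact_UNIV_unit_interval, of f]
  by (auto simp: bcontfun_def compact_imp_bounded)

lemma bcontfun_lift_unit_interval:
  fixes h :: "real \<Rightarrow> real"
  assumes "continuous_on {0..1} h"
  shows "(\<lambda>x. h (real_of_ui x)) \<in> bcontfun"
proof -
  have "continuous_on UNIV real_of_ui"
    unfolding continuous_on_iff by (auto simp: dist_unit_interval_def)
  moreover have "range real_of_ui \<subseteq> {0..1}"
    using real_of_ui by auto
  ultimately show ?thesis
    unfolding bcontfun_unit_interval_iff
    using continuous_on_compose2[OF assms] by blast
qed

lemma norm_C01_attained:
  fixes f :: C01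
  shows "\<exists>x. norm f = \<bar>apply_bcontfun f x\<bar> \<and> (\<forall>y. \<bar>apply_bcontfun f y\<bar> \<le> \<bar>apply_bcontfun f x\<bar>)"
proof -
  have "continuous_on UNIV (\<lambda>x. \<bar>apply_bcontfun f x\<bar>)"
    using apply_bcontfun[of f] by (intro continuous_intros) (simp add: bcontfun_def)
  then obtain x where x: "\<And>y. \<bar>apply_bcontfun f y\<bar> \<le> \<bar>apply_bcontfun f x\<bar>"
    using continuous_attains_sup[OF compact_UNIV_unit_interval] by blast
  have "norm f \<le> \<bar>apply_bcontfun f x\<bar>"
    by (rule norm_bound) (simp add: x)
  moreover have "\<bar>apply_bcontfun f x\<bar> \<le> norm f"
    using norm_bounded[of f x] by simp
  ultimately show ?thesis using x by (intro exI[of _ x]) auto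
qed

definition poly_space :: "nat \<Rightarrow> C01 set" where
  "poly_space n = {F. \<exists>q::real poly. degree q \<le> n \<and>
     (\<forall>x. apply_bcontfun F x = poly q (real_of_ui x))}"

text \<open>Only meaningful at points that have exactly one nearest point in \<open>K\<close>.\<close>

definition metric_projection :: "'a::real_normed_vector set \<Rightarrow> 'a \<Rightarrow> 'a" where
  "metric_projection K f = (THE p. p \<in> K \<and> (\<forall>q\<in>K. norm (f - p) \<le> norm (f - q)))"

text \<open>One-sided: the limit is taken over \<open>t > 0\<close> only, in the norm topology of the codomain.\<close>

definition has_directional_derivative ::
    "('a::real_normed_vector \<Rightarrow> 'b::real_normed_vector) \<Rightarrow> 'a \<Rightarrow> 'a \<Rightarrow> 'b \<Rightarrow> bool" where
  "has_directional_derivative T f g d \<longleftrightarrow>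
     ((\<lambda>t::real. (T (f + t *\<^sub>R g) - T f) /\<^sub>R t) \<longlongrightarrow> d) (at_right 0)"

end

theory Submission
  imports Defs
begin

text \<open>
  The nearest points of a subspace \<open>K\<close> to \<open>f + u\<close> with \<open>u \<in> K\<close> are the translates by \<open>u\<close> of the
  nearest points to \<open>f\<close>. Hence, as soon as nearest points exist and are unique, the metric
  projection satisfies \<open>P (f + t p) = P f + t p\<close>, and every difference quotient in the direction
  \<open>p\<close> equals \<open>p\<close>. What has to be shown is therefore that every \<open>f\<close> in \<open>C[0,1]\<close> has exactly one
  best approximation of degree at most \<open>n\<close>.

  Existence holds in every finite-dimensional subspace, because its bounded closed parts are
  compact (\<open>compact_span_Int_cball\<close>, \<open>span_nearest_point_exists\<close>).

  Uniqueness rests on counting zeros. If \<open>p\<close> and \<open>q\<close> are both nearest, so is their midpoint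
  \<open>r\<close>, and at each point where \<open>|f - r|\<close> is maximal the errors of \<open>p\<close> and \<open>q\<close> must both agree
  with that of \<open>r\<close>, so \<open>p = q\<close> there. If there are more than \<open>n\<close> such points, the polynomial
  \<open>p - q\<close> has too many zeros and vanishes. If there were at most \<open>n\<close> of them, some polynomial of
  degree at most \<open>n\<close> would interpolate \<open>f - r\<close> on them, and moving \<open>r\<close> slightly in its direction
  would strictly decrease the error (\<open>norm_decreases_along_same_sign\<close>), contradicting that \<open>r\<close>
  is nearest.
\<close>

section \<open>Nearest points in finite-dimensional subspaces\<close>

lemma closed_if_compact_Int_cball:
  fixes K :: "'a::real_normed_vector set"
  assumes "\<And>r. compact (K \<inter> cball 0 r)"
  shows "closed K"
  unfolding closed_sequential_limits
proof (intro allI impI, elim conjE)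
  fix x l assume x: "\<forall>n. x n \<in> K" and lim: "x \<longlonglongrightarrow> l"
  obtain r where "\<And>n. norm (x n) \<le> r"
    using convergent_imp_bounded[OF lim] by (auto simp: bounded_iff)
  with x have "\<forall>n. x n \<in> K \<inter> cball 0 r" by simp
  with lim have "l \<in> K \<inter> cball 0 r"
    using compact_imp_closed[OF assms[of r]] closed_sequentially by metis
  then show "l \<in> K" by simp
qed

text \<open>A vector outside a closed subspace \<open>K\<close> has positive distance to it, so in \<open>k + c a\<close> both the
  coefficient \<open>c\<close> and the part \<open>k\<close> are bounded in terms of the norm of the whole.\<close>

lemma compact_span_Int_cball:
  fixes B :: "'a::real_normed_vector set"
  assumes "finite B"
  shows "compact (span B \<inter> cball 0 r)"
  using assms
proof (induction B arbitrary: r rule: finite_induct)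
  case empty
  then show ?case by (auto simp: Int_insert_left)
next
  case (insert a B)
  show ?case
  proof (cases "a \<in> span B")
    case True
    then have "span (insert a B) = span B" by (rule span_redundant)
    then show ?thesis using insert.IH by simp
  next
    case False
    have "closed (span B)" using insert.IH by (rule closed_if_compact_Int_cball)
    then obtain d where "d > 0" "ball a d \<subseteq> - span B"
      using False by (meson ComplI openE open_Compl)
    then have d: "d > 0" "\<And>k. k \<in> span B \<Longrightarrow> d \<le> dist a k"
      by (force simp: subset_iff not_less)+
    have coeff_bound: "\<bar>c\<bar> * d \<le> norm x" if "x - c *\<^sub>R a \<in> span B" for c x
    proof (cases "c = 0")
      case nz: False
      have "a - x /\<^sub>R c = (- 1 / c) *\<^sub>R (x - c *\<^sub>R a)"
        using nz by (simp add: algebra_simps divide_inverse)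
      then have "a - x /\<^sub>R c \<in> span B"
        using span_scale[OF that, of "- 1 / c"] by simp
      then have "d \<le> norm (x /\<^sub>R c)" using d(2) by (force simp: dist_norm)
      then show ?thesis using nz by (simp add: field_simps)
    qed simp
    define S where "S = (span B \<inter> cball 0 (r + (r / d) * norm a)) \<times> {- (r / d)..r / d}"
    define T where "T = (\<lambda>(k, c). k + c *\<^sub>R a) ` S"
    have "compact T"
      unfolding T_def S_def case_prod_unfold
      by (intro compact_continuous_image compact_Times insert.IH continuous_intros) auto
    moreover have "span (insert a B) \<inter> cball 0 r = T \<inter> cball 0 r"
    proof (intro set_eqI iffI)
      fix x assume x: "x \<in> span (insert a B) \<inter> cball 0 r"
      then obtain c where c: "x - c *\<^sub>R a \<in> span B" by (auto simp: span_insert)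
      have "\<bar>c\<bar> * d \<le> r" using coeff_bound[OF c] x by simp
      then have cr: "\<bar>c\<bar> \<le> r / d" using d(1) by (simp add: field_simps)
      have "norm (x - c *\<^sub>R a) \<le> norm x + \<bar>c\<bar> * norm a"
        using norm_triangle_ineq4[of x "c *\<^sub>R a"] by simp
      also have "\<dots> \<le> r + (r / d) * norm a"
        using x cr by (intro add_mono mult_right_mono) auto
      finally have "(x - c *\<^sub>R a, c) \<in> S" using c cr by (auto simp: S_def)
      then show "x \<in> T \<inter> cball 0 r" using x by (force simp: T_def)
    next
      fix x assume x: "x \<in> T \<inter> cball 0 r"
      then obtain k c where "k \<in> span B" "x = k + c *\<^sub>R a" by (auto simp: T_def S_def)
      then show "x \<in> span (insert a B) \<inter> cball 0 r"
        using x by (auto simp: span_insert intro!: exI[of _ c])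
    qed
    ultimately show ?thesis by (simp add: compact_Int_closed)
  qed
qed

lemma span_nearest_point_exists:
  fixes B :: "'a::real_normed_vector set"
  assumes "finite B"
  shows "\<exists>p\<in>span B. \<forall>q\<in>span B. norm (f - p) \<le> norm (f - q)"
proof -
  \<comment> \<open>Outside the ball of radius \<open>2 * norm f\<close> no point beats the origin.\<close>
  let ?S = "span B \<inter> cball 0 (2 * norm f)"
  have "?S \<noteq> {}" using span_zero[of B] by auto
  then obtain p where p: "p \<in> ?S" "\<And>q. q \<in> ?S \<Longrightarrow> norm (f - p) \<le> norm (f - q)"
    using continuous_attains_inf[OF compact_span_Int_cball[OF assms], of _ "\<lambda>q. norm (f - q)"]
    by (force intro!: continuous_intros)
  have "norm (f - p) \<le> norm (f - q)" if "q \<in> span B" for q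
  proof (cases "norm q \<le> 2 * norm f")
    case True
    then show ?thesis using p(2) that by simp
  next
    case False
    have "norm (f - p) \<le> norm (f - 0)" using span_zero by (intro p(2)) auto
    also have "\<dots> \<le> norm (f - q)"
      using False norm_triangle_ineq2[of q f] by (simp add: norm_minus_commute)
    finally show ?thesis .
  qed
  then show ?thesis using p(1) by blast
qed

section \<open>Polynomials as a subspace of continuous functions\<close>

lemma subspace_poly_space: "subspace (poly_space n)"
proof (rule subspaceI)
  show "0 \<in> poly_space n"
    by (auto simp: poly_space_def intro!: exI[of _ 0])
next
  fix F G assume "F \<in> poly_space n" "G \<in> poly_space n"
  then obtain q s where "degree q \<le> n" "degree s \<le> n"
    "\<And>x. apply_bcontfun F x = poly q (real_of_ui x)"
    "\<And>x. apply_bcontfun G x = poly s (real_of_ui x)"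
    unfolding poly_space_def by blast
  then show "F + G \<in> poly_space n"
    by (auto simp: poly_space_def intro!: exI[of _ "q + s"] degree_add_le)
next
  fix c F assume "F \<in> poly_space n"
  then obtain q where "degree q \<le> n" "\<And>x. apply_bcontfun F x = poly q (real_of_ui x)"
    unfolding poly_space_def by blast
  then show "c *\<^sub>R F \<in> poly_space n"
    by (auto simp: poly_space_def intro!: exI[of _ "smult c q"] order.trans[OF degree_smult_le])
qed

definition C01_of_poly :: "real poly \<Rightarrow> C01" where
  "C01_of_poly q = Bcontfun (\<lambda>x. poly q (real_of_ui x))"

lemma apply_C01_of_poly: "apply_bcontfun (C01_of_poly q) x = poly q (real_of_ui x)"
  unfolding C01_of_poly_def
  by (subst Bcontfun_inverse) (auto intro!: bcontfun_lift_unit_interval continuous_intros)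

lemma C01_of_poly_in_poly_space: "degree q \<le> n \<Longrightarrow> C01_of_poly q \<in> poly_space n"
  by (auto simp: poly_space_def apply_C01_of_poly)

lemma poly_space_eq_span: "poly_space n = span ((\<lambda>i. C01_of_poly (monom 1 i)) ` {..n})"
proof
  show "poly_space n \<subseteq> span ((\<lambda>i. C01_of_poly (monom 1 i)) ` {..n})"
  proof
    fix F assume "F \<in> poly_space n"
    then obtain q where q: "degree q \<le> n" "\<And>x. apply_bcontfun F x = poly q (real_of_ui x)"
      unfolding poly_space_def by blast
    have eval_sum: "apply_bcontfun (\<Sum>i\<in>A. G i) x = (\<Sum>i\<in>A. apply_bcontfun (G i) x)"
      for A :: "nat set" and G :: "nat \<Rightarrow> C01" and x
      by (induction A rule: infinite_finite_induct) auto
    have "poly q y = (\<Sum>i\<le>n. coeff q i * y ^ i)" for y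
      using q(1) by (auto simp: poly_altdef intro: le_degree intro!: sum.mono_neutral_left)
    then have "F = (\<Sum>i\<le>n. coeff q i *\<^sub>R C01_of_poly (monom 1 i))"
      by (auto intro!: bcontfun_eqI simp: eval_sum q apply_C01_of_poly poly_monom)
    then show "F \<in> span ((\<lambda>i. C01_of_poly (monom 1 i)) ` {..n})"
      by (auto intro!: span_sum span_scale intro: span_base)
  qed
  show "span ((\<lambda>i. C01_of_poly (monom 1 i)) ` {..n}) \<subseteq> poly_space n"
    by (intro span_minimal subspace_poly_space)
      (auto intro!: C01_of_poly_in_poly_space order.trans[OF degree_monom_le])
qed

lemma poly_space_nearest_point_exists:
  "\<exists>p\<in>poly_space n. \<forall>q\<in>poly_space n. norm (f - p) \<le> norm (f - q)"
  unfolding poly_space_eq_span by (rule span_nearest_point_exists) simp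

text \<open>The degree bound is one more than optimal; this spares the empty set a special case.\<close>

lemma polynomial_interpolation_exists:
  fixes g :: "'a::field \<Rightarrow> 'a"
  assumes "finite A"
  shows "\<exists>s. degree s \<le> card A \<and> (\<forall>a\<in>A. poly s a = g a)"
  using assms
proof (induction A rule: finite_induct)
  case empty
  then show ?case by (intro exI[of _ 0]) simp
next
  case (insert b A)
  then obtain s where s: "degree s \<le> card A" "\<And>a. a \<in> A \<Longrightarrow> poly s a = g a" by blast
  define w where "w = (\<Prod>a\<in>A. [:- a, 1:])"
  have w: "degree w \<le> card A" "\<And>a. a \<in> A \<Longrightarrow> poly w a = 0" "poly w b \<noteq> 0"
    using insert.hyps degree_prod_sum_le[OF insert.hyps(1), of "\<lambda>a. [:- a, 1:]"]
    by (auto simp: w_def poly_prod)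
  let ?s = "s + smult ((g b - poly s b) / poly w b) w"
  have "degree ?s \<le> card A"
    using s(1) w(1) by (intro degree_add_le order.trans[OF degree_smult_le])
  then show ?case
    using insert.hyps s w by (intro exI[of _ ?s]) auto
qed

lemma poly_space_eqI:
  assumes F: "F \<in> poly_space n" and G: "G \<in> poly_space n"
    and agree: "\<And>x. x \<in> Z \<Longrightarrow> apply_bcontfun F x = apply_bcontfun G x"
    and many: "\<not> (finite Z \<and> card Z \<le> n)"
  shows "F = G"
proof -
  obtain d where d: "degree d \<le> n" "\<And>x. apply_bcontfun (F - G) x = poly d (real_of_ui x)"
    using subspace_diff[OF subspace_poly_space F G] unfolding poly_space_def by blast
  have roots: "real_of_ui ` Z \<subseteq> {x. poly d x = 0}"
    using agree d(2) by (auto simp flip: d(2))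
  have inj: "inj_on real_of_ui Z"
    by (auto simp: inj_on_def real_of_ui_inject)
  have "d = 0"
  proof (rule ccontr)
    assume nz: "d \<noteq> 0"
    then have "finite (real_of_ui ` Z)"
      using poly_roots_finite finite_subset[OF roots] by blast
    moreover have "card (real_of_ui ` Z) \<le> degree d"
      using nz card_mono[OF poly_roots_finite roots] card_poly_roots_bound[of d] by linarith
    ultimately show False
      using many d(1) inj by (auto simp: card_image finite_image_iff)
  qed
  then have "F - G = 0" using d(2) by (intro bcontfun_eqI) simp
  then show ?thesis by simp
qed

section \<open>Uniqueness of the best approximation\<close>

text \<open>On the closed set where \<open>h s \<le> 0\<close>, compactness leaves a gap below \<open>norm h\<close> that a small
  multiple of \<open>s\<close> cannot fill. Elsewhere \<open>h\<close> and \<open>s\<close> have the same sign, so subtracting gives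
  \<open>|h - e s| < max |h| |e s|\<close> without any uniform lower bound on \<open>h s\<close>.\<close>

lemma norm_decreases_along_same_sign:
  fixes h s :: C01
  assumes same_sign: "\<And>x. \<bar>apply_bcontfun h x\<bar> = norm h \<Longrightarrow>
    apply_bcontfun h x * apply_bcontfun s x > 0"
  shows "\<exists>e>0. norm (h - e *\<^sub>R s) < norm h"
proof -
  have le_norm: "\<bar>apply_bcontfun F x\<bar> \<le> norm F" for F :: C01 and x
    using norm_bounded[of F x] by simp
  define K where "K = {x. apply_bcontfun h x * apply_bcontfun s x \<le> 0}"
  have "closed K"
    unfolding K_def by (intro closed_Collect_le continuous_intros continuous_on_apply_bcontfun)
  then have "compact K"
    using compact_Int_closed[OF compact_UNIV_unit_interval] by simp
  have "\<exists>E. 0 \<le> E \<and> E < norm h \<and> (\<forall>x\<in>K. \<bar>apply_bcontfun h x\<bar> \<le> E)"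
  proof (cases "K = {}")
    case True
    have "h \<noteq> 0"
      using norm_C01_attained[of h] same_sign by force
    then show ?thesis using True by (intro exI[of _ 0]) simp
  next
    case False
    have "continuous_on K (\<lambda>x. \<bar>apply_bcontfun h x\<bar>)"
      by (intro continuous_intros continuous_on_apply_bcontfun)
    then obtain z where z: "z \<in> K" "\<And>x. x \<in> K \<Longrightarrow> \<bar>apply_bcontfun h x\<bar> \<le> \<bar>apply_bcontfun h z\<bar>"
      using continuous_attains_sup[OF \<open>compact K\<close> False] by blast
    have "\<bar>apply_bcontfun h z\<bar> \<noteq> norm h" using z(1) same_sign[of z] by (auto simp: K_def)
    then show ?thesis using z le_norm[of h z] by (intro exI[of _ "\<bar>apply_bcontfun h z\<bar>"]) auto
  qed
  then obtain E where E: "0 \<le> E" "E < norm h" "\<And>x. x \<in> K \<Longrightarrow> \<bar>apply_bcontfun h x\<bar> \<le> E" by blast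
  define e where "e = (norm h - E) / (norm s + 1)"
  have "norm s + 1 > 0" using norm_ge_zero[of s] by linarith
  then have e: "e > 0" "e * norm s < norm h - E"
    using E(2) by (simp_all add: e_def field_simps)
  obtain x where x: "norm (h - e *\<^sub>R s) = \<bar>apply_bcontfun (h - e *\<^sub>R s) x\<bar>"
    using norm_C01_attained by blast
  let ?a = "apply_bcontfun h x" and ?b = "e * apply_bcontfun s x"
  have b: "\<bar>?b\<bar> \<le> e * norm s"
    using e(1) le_norm[of s x] by (simp add: abs_mult)
  have "\<bar>?a - ?b\<bar> < norm h"
  proof (cases "x \<in> K")
    case True
    then show ?thesis using E(3)[of x] e(2) b by linarith
  next
    case False
    then have "?a > 0 \<and> ?b > 0 \<or> ?a < 0 \<and> ?b < 0"
      using e(1) by (auto simp: K_def not_le zero_less_mult_iff mult_less_0_iff)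
    then show ?thesis using le_norm[of h x] b e(2) E(1) by linarith
  qed
  then show ?thesis using x e(1) by auto
qed

text \<open>With few extremal points an interpolant of \<open>f - r\<close> on them would be a descent direction.\<close>

lemma nearest_poly_has_many_extremal_points:
  assumes r: "r \<in> poly_space n" and nearest: "\<And>q. q \<in> poly_space n \<Longrightarrow> norm (f - r) \<le> norm (f - q)"
    and Z_def: "Z = {x. \<bar>apply_bcontfun (f - r) x\<bar> = norm (f - r)}"
  shows "\<not> (finite Z \<and> card Z \<le> n)"
proof
  assume few: "finite Z \<and> card Z \<le> n"
  have card: "card (real_of_ui ` Z) \<le> n"
    using few card_image_le[of Z real_of_ui] by linarith
  obtain q where q: "degree q \<le> card (real_of_ui ` Z)"
    "\<And>x. x \<in> Z \<Longrightarrow> poly q (real_of_ui x) = apply_bcontfun (f - r) x"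
    using polynomial_interpolation_exists[of "real_of_ui ` Z" "\<lambda>y. apply_bcontfun (f - r) (ui_of_real y)"]
      few by (auto simp: real_of_ui_inverse)
  define s where "s = C01_of_poly q"
  have s: "s \<in> poly_space n"
    unfolding s_def using q(1) card by (intro C01_of_poly_in_poly_space) linarith
  have "f \<noteq> r"
  proof
    \<comment> \<open>A zero error is extremal everywhere, and the unit interval is infinite.\<close>
    assume "f = r"
    then have "Z = UNIV" by (simp add: Z_def)
    then have "finite (real_of_ui ` UNIV)" using few by simp
    then show False
      using type_definition.Rep_range[OF type_definition_unit_interval]
      by (simp add: infinite_Icc)
  qed
  then have "apply_bcontfun (f - r) x * apply_bcontfun s x > 0"
    if "\<bar>apply_bcontfun (f - r) x\<bar> = norm (f - r)" for x
  proof -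
    have "apply_bcontfun s x = apply_bcontfun (f - r) x"
      using q(2)[of x] that by (simp add: s_def apply_C01_of_poly Z_def)
    moreover have "apply_bcontfun (f - r) x \<noteq> 0"
      using that \<open>f \<noteq> r\<close> by (metis abs_zero norm_eq_zero right_minus_eq)
    ultimately show ?thesis by (metis not_real_square_gt_zero)
  qed
  then obtain e where e: "norm (f - r - e *\<^sub>R s) < norm (f - r)"
    using norm_decreases_along_same_sign by blast
  have "r + e *\<^sub>R s \<in> poly_space n"
    using r s by (intro subspace_add subspace_scale subspace_poly_space)
  then show False using nearest e by (force simp: diff_diff_eq)
qed

lemma nearest_poly_unique:
  assumes p: "p \<in> poly_space n" "\<And>u. u \<in> poly_space n \<Longrightarrow> norm (f - p) \<le> norm (f - u)"
    and q: "q \<in> poly_space n" "\<And>u. u \<in> poly_space n \<Longrightarrow> norm (f - q) \<le> norm (f - u)"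
  shows "p = q"
proof -
  define r where "r = (1 / 2) *\<^sub>R (p + q)"
  have r: "r \<in> poly_space n"
    unfolding r_def using p q by (intro subspace_add subspace_scale subspace_poly_space)
  have eq: "norm (f - p) = norm (f - q)"
    using p q by (intro antisym) auto
  have "2 *\<^sub>R (f - r) = (f - p) + (f - q)"
    unfolding r_def by (rule bcontfun_eqI) (simp add: field_simps)
  then have "2 * norm (f - r) \<le> norm (f - p) + norm (f - q)"
    by (metis abs_numeral norm_scaleR norm_triangle_ineq)
  then have norm_r: "norm (f - r) = norm (f - p)"
    using p(2)[OF r] eq by simp
  define Z where "Z = {x. \<bar>apply_bcontfun (f - r) x\<bar> = norm (f - r)}"
  have "\<not> (finite Z \<and> card Z \<le> n)"
    using r _ Z_def
    by (rule nearest_poly_has_many_extremal_points) (simp add: norm_r p(2))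
  moreover have "apply_bcontfun p x = apply_bcontfun q x" if "x \<in> Z" for x
  proof -
    have "apply_bcontfun (f - p) x + apply_bcontfun (f - q) x = 2 * apply_bcontfun (f - r) x"
      by (simp add: r_def field_simps)
    moreover have "\<bar>apply_bcontfun (f - r) x\<bar> = norm (f - p)"
      using that by (simp add: Z_def norm_r)
    moreover have "\<bar>apply_bcontfun (f - p) x\<bar> \<le> norm (f - p)"
      using norm_bounded[of "f - p" x] by (simp only: real_norm_def)
    moreover have "\<bar>apply_bcontfun (f - q) x\<bar> \<le> norm (f - p)"
      using norm_bounded[of "f - q" x] by (simp only: real_norm_def eq)
    \<comment> \<open>Two numbers of modulus at most \<open>m\<close> whose mean has modulus \<open>m\<close> coincide.\<close>
    ultimately have "apply_bcontfun (f - p) x = apply_bcontfun (f - q) x"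
      by argo
    then show ?thesis by simp
  qed
  ultimately show ?thesis
    using poly_space_eqI p(1) q(1) by blast
qed

section \<open>The metric projection along the subspace\<close>

lemma metric_projection_add_subspace:
  fixes K :: "'a::real_normed_vector set"
  assumes K: "subspace K" and u: "u \<in> K"
    and ex1: "\<And>g. \<exists>!p. p \<in> K \<and> (\<forall>q\<in>K. norm (g - p) \<le> norm (g - q))"
  shows "metric_projection K (f + u) = metric_projection K f + u"
proof -
  define P where "P = metric_projection K f"
  have P: "P \<in> K" "\<And>q. q \<in> K \<Longrightarrow> norm (f - P) \<le> norm (f - q)"
    using theI'[OF ex1[of f]] by (simp_all add: P_def metric_projection_def)
  have "norm (f + u - (P + u)) \<le> norm (f + u - q)" if "q \<in> K" for q
    using P(2)[OF subspace_diff[OF K that u]] by (simp add: algebra_simps)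
  then show ?thesis
    unfolding metric_projection_def[of K "f + u"] P_def[symmetric]
    using subspace_add[OF K P(1) u] by (intro the1_equality[OF ex1]) blast
qed

theorem proposition5p11:
  fixes n :: nat and f p :: C01
  assumes "p \<in> poly_space n - {0}"
  shows "has_directional_derivative (metric_projection (poly_space n)) f p p"
proof -
  have "\<exists>!p. p \<in> poly_space n \<and> (\<forall>q\<in>poly_space n. norm (g - p) \<le> norm (g - q))" for g
    using poly_space_nearest_point_exists[of n g] nearest_poly_unique[of _ n g] by blast
  then have "metric_projection (poly_space n) (f + t *\<^sub>R p)
      = metric_projection (poly_space n) f + t *\<^sub>R p" for t
    using assms by (intro metric_projection_add_subspace subspace_poly_space subspace_scale) auto
  then have "\<forall>\<^sub>F t in at_right 0. (metric_projection (poly_space n) (f + t *\<^sub>R p)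
      - metric_projection (poly_space n) f) /\<^sub>R t = p"
    by (auto simp: eventually_at_filter)
  then show ?thesis
    unfolding has_directional_derivative_def by (rule tendsto_eventually)
qed

end
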